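(* Let $\varphi_1:\mathbb R^p\to\mathbb R$ be differentiable with $L$-Lipschitz gradient, let $\varphi_2:\mathbb R^p\to\mathbb R\cup\{\infty\}$ be proper and lower semicontinuous, and suppose that $\operatorname{argmin}(\varphi_1+\varphi_2)\ne\emptyset$. For all $0<\gamma<1/L$ the Douglas-Rachford envelope $\varphi_\gamma^{\rm dr}$ is a real-valued and strictly continuous (i.e. locally Lipschitz continuous) function on $\mathbb R^p$.
   Context: Convention $1/0=\infty$. $\operatorname{prox}_{\gamma h}(x)=\operatorname{argmin}_w\{h(w)+\frac1{2\gamma}\|w-x\|^2\}$; for $\gamma<1/L$, $\operatorname{prox}_{\gamma\varphi_1}$ is single valued. Douglas-Rachford envelope: with $u=\operatorname{prox}_{\gamma\varphi_1}(s)$, $$\varphi_\gamma^{\rm dr}(s)=\min_{w\in\mathbb R^p}\{\varphi_2(w)+\varphi_1(u)+\langle\nabla\varphi_1(u),w-u\rangle+\tfrac1{2\gamma}\|w-u\|^2\}.$$ *)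

theory Defs
  imports "HOL-Analysis.Analysis"
begin

definition grad :: "('a::real_inner \<Rightarrow> real) \<Rightarrow> 'a \<Rightarrow> 'a" where
  "grad f x = (THE g. GDERIV f x :> g)"

definition proper :: "('a \<Rightarrow> ereal) \<Rightarrow> bool" where
  "proper f \<longleftrightarrow> (\<forall>x. f x \<noteq> -\<infinity>) \<and> (\<exists>x. f x \<noteq> \<infinity>)"

definition lower_semicontinuous :: "('a::topological_space \<Rightarrow> ereal) \<Rightarrow> bool" where
  "lower_semicontinuous f \<longleftrightarrow> (\<forall>x. f x \<le> Liminf (at x) f)"

definition argmin_set :: "('a \<Rightarrow> ereal) \<Rightarrow> 'a set" where
  "argmin_set f = {x. is_arg_min f (\<lambda>_. True) x}"

definition strictly_continuous :: "('a::metric_space \<Rightarrow> 'b::metric_space) \<Rightarrow> bool" where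
  "strictly_continuous f \<longleftrightarrow> (\<forall>x. \<exists>e>0. \<exists>K. K-lipschitz_on (ball x e) f)"

definition prox :: "real \<Rightarrow> ('a::real_inner \<Rightarrow> ereal) \<Rightarrow> 'a \<Rightarrow> 'a set" where
  "prox \<gamma> h x = argmin_set (\<lambda>w. h w + ereal ((norm (w - x))\<^sup>2 / (2 * \<gamma>)))"

(* the_elem picks the unique proximal point and LEAST is an attained minimum, not an infimum:
   if the proximal set is not a singleton, or if no minimiser w exists, the corresponding value is
   unspecified, so reasoning about the envelope requires establishing both facts. *)
definition DR_envelope ::
    "real \<Rightarrow> ('a::real_inner \<Rightarrow> real) \<Rightarrow> ('a \<Rightarrow> ereal) \<Rightarrow> 'a \<Rightarrow> ereal" where
  "DR_envelope \<gamma> \<phi>1 \<phi>2 s =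
     (let u = the_elem (prox \<gamma> (\<lambda>w. ereal (\<phi>1 w)) s) in
      LEAST m. m \<in> range (\<lambda>w. \<phi>2 w +
        ereal (\<phi>1 u + grad \<phi>1 u \<bullet> (w - u) + (norm (w - u))\<^sup>2 / (2 * \<gamma>))))"

end

theory Submission
  imports Defs
begin

text \<open>
  Write \<open>u = prox_{\<gamma>\<phi>1}(s)\<close> and let \<open>model u w\<close> be the real-valued part of the function minimised in the
  envelope: the linearisation of \<open>\<phi>1\<close> at \<open>u\<close> plus the proximal term. Everything rests on the
  descent lemma: \<open>\<phi>1\<close> deviates from its linearisation at \<open>u\<close> by at most
  \<open>L/2 * norm (w - u)^2\<close>, in both directions, and \<open>\<gamma> < 1/L\<close> makes the proximal term dominate this
  error.

  \<^item> The point \<open>u\<close> solves \<open>u + \<gamma> \<nabla>\<phi>1(u) = s\<close>. This equation has exactly one solution, as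
    \<open>u \<mapsto> s - \<gamma> \<nabla>\<phi>1(u)\<close> is a \<open>\<gamma>L\<close>-contraction; subtracting two such equations shows that \<open>u\<close>
    is Lipschitz in \<open>s\<close>, and the descent lemma shows that a solution is the unique strict minimiser
    in the definition of the proximal map (lemmas \<open>ex1_resolvent\<close>, \<open>norm_resolvent_diff_le\<close>,
    \<open>prox_eq_resolvent\<close>).

  \<^item> Likewise \<open>model u w\<close> is squeezed between \<open>\<phi>1(w)\<close> plus two positive multiples of
    \<open>norm (w - u)^2\<close>. Since \<open>\<phi>1 + \<phi>2\<close> is minimal at some \<open>x\<close>, every \<open>w\<close> that does at least as well
    as \<open>x\<close> satisfies \<open>norm (w - u) \<le> \<kappa> * norm (x - u)\<close> for a constant \<open>\<kappa>\<close>. Hence sublevel sets are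
    bounded, lower semicontinuity gives a minimiser, and the minimisers stay bounded as long as \<open>u\<close>
    does (lemmas \<open>lsc_attains_minimum\<close>, \<open>DR_envelope_attained\<close>).

  \<^item> A minimiser \<open>w\<close> for \<open>s\<close> is a competitor for \<open>s'\<close>, so the envelope at \<open>s'\<close> exceeds that at \<open>s\<close>
    by at most \<open>model u' w - model u w\<close>. The function \<open>\<phi>2\<close> has cancelled, and the difference is at most a
    constant times \<open>norm (u' - u)\<close>, where the constant depends only on the bounds for \<open>w - u\<close> and
    \<open>u' - u\<close> (lemma \<open>model_diff_le\<close>). Exchanging \<open>s\<close> and \<open>s'\<close> gives the local Lipschitz estimate.
\<close>

section \<open>Gradients and the descent lemma\<close>

lemma GDERIV_grad:
  fixes f :: "'a::euclidean_space \<Rightarrow> real"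
  assumes "f differentiable (at x)"
  shows "GDERIV f x :> grad f x"
proof -
  obtain f' where f': "(f has_derivative f') (at x)"
    using assms by (auto simp: differentiable_def)
  then have "linear f'" by (rule has_derivative_linear)
  then have "f' = (\<lambda>h. h \<bullet> adjoint f' 1)"
    by (simp add: fun_eq_iff adjoint_works)
  with f' have ex: "GDERIV f x :> adjoint f' 1"
    by (simp add: gderiv_def)
  have "a = b" if "GDERIV f x :> a" "GDERIV f x :> b" for a b
  proof -
    have "(\<lambda>h. h \<bullet> a) = (\<lambda>h. h \<bullet> b)"
      using that unfolding gderiv_def by (rule has_derivative_unique)
    then show "a = b" by (metis inner_commute vector_eq_rdot)
  qed
  with ex show ?thesis
    unfolding grad_def by (intro theI[of "\<lambda>g. GDERIV f x :> g"]) auto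
qed

text \<open>
  Along the segment from \<open>u\<close> to \<open>w\<close>, the error of the linearisation has slope at most
  \<open>L t norm (w - u)^2\<close> at time \<open>t\<close>; integrating this over the unit interval produces the factor 1/2.
\<close>

lemma descent_upper:
  fixes f :: "'a::real_inner \<Rightarrow> real"
  assumes D: "\<And>x. GDERIV f x :> G x" and lip: "L-lipschitz_on UNIV G"
  shows "f w - f u - G u \<bullet> (w - u) \<le> L / 2 * (norm (w - u))\<^sup>2"
proof -
  define d where "d = w - u"
  define h where "h = (\<lambda>t::real. f (u + t *\<^sub>R d) - t * (G u \<bullet> d) - L / 2 * t\<^sup>2 * (norm d)\<^sup>2)"
  have nonpos: "\<exists>y. DERIV h t :> y \<and> y \<le> 0" if t: "0 \<le> t" for t
  proof (intro exI conjI)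
    have "((\<lambda>t. u + t *\<^sub>R d) has_derivative (\<lambda>k. k *\<^sub>R d)) (at t)"
      by (auto intro!: derivative_eq_intros)
    from has_derivative_compose[OF this D[of "u + t *\<^sub>R d", unfolded gderiv_def]]
    have "DERIV (\<lambda>t. f (u + t *\<^sub>R d)) t :> G (u + t *\<^sub>R d) \<bullet> d"
      by (simp add: has_field_derivative_def inner_commute mult_commute_abs)
    then show "DERIV h t :> G (u + t *\<^sub>R d) \<bullet> d - G u \<bullet> d - L * t * (norm d)\<^sup>2"
      unfolding h_def by (auto intro!: derivative_eq_intros)
    have "(G (u + t *\<^sub>R d) - G u) \<bullet> d \<le> norm (G (u + t *\<^sub>R d) - G u) * norm d"
      by (rule norm_cauchy_schwarz)
    also have "\<dots> \<le> (L * (t * norm d)) * norm d"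
      using lipschitz_onD[OF lip, of "u + t *\<^sub>R d" u] t
      by (intro mult_right_mono) (auto simp: dist_norm)
    finally show "G (u + t *\<^sub>R d) \<bullet> d - G u \<bullet> d - L * t * (norm d)\<^sup>2 \<le> 0"
      by (simp add: inner_diff_left power2_eq_square mult_ac)
  qed
  have "h 1 \<le> h 0"
    by (rule DERIV_nonpos_imp_nonincreasing[OF zero_le_one nonpos])
  then show ?thesis by (simp add: h_def d_def)
qed

lemma descent:
  fixes f :: "'a::real_inner \<Rightarrow> real"
  assumes D: "\<And>x. GDERIV f x :> G x" and lip: "L-lipschitz_on UNIV G"
  shows "\<bar>f w - f u - G u \<bullet> (w - u)\<bar> \<le> L / 2 * (norm (w - u))\<^sup>2"
proof -
  have "L-lipschitz_on UNIV (\<lambda>x. - G x)"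
    using lip by (simp add: lipschitz_on_def)
  from descent_upper[OF GDERIV_minus[OF D] this, of w u] descent_upper[OF D lip, of w u]
  show ?thesis unfolding inner_minus_left by linarith
qed

section \<open>Attained minima of lower semicontinuous functions\<close>

lemma lower_semicontinuousD:
  assumes "lower_semicontinuous F" and "c < F x"
  shows "eventually (\<lambda>y. c < F y) (at x)"
  using assms less_LiminfD[OF less_le_trans] unfolding lower_semicontinuous_def by blast

lemma lower_semicontinuous_add_continuous:
  fixes g :: "'a::topological_space \<Rightarrow> ereal" and q :: "'a \<Rightarrow> real"
  assumes g: "lower_semicontinuous g" and q: "continuous_on UNIV q"
  shows "lower_semicontinuous (\<lambda>x. g x + ereal (q x))"
  unfolding lower_semicontinuous_def le_Liminf_iff
proof (intro allI impI)
  fix x y assume y: "y < g x + ereal (q x)"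
  then have "y - ereal (q x) < g x"
    by (cases y; cases "g x") auto
  \<comment> \<open>The slack between \<open>g x\<close> and a real \<open>z\<close> below it absorbs the variation of \<open>q\<close>.\<close>
  then obtain z where z: "y - ereal (q x) < ereal z" "ereal z < g x"
    using ereal_dense2 by blast
  have "eventually (\<lambda>x'. ereal z < g x') (at x)"
    by (rule lower_semicontinuousD[OF g z(2)])
  moreover have "((\<lambda>x'. ereal (z + q x')) \<longlongrightarrow> ereal (z + q x)) (at x)"
    using q by (intro tendsto_intros) (auto simp: continuous_on_def)
  then have "eventually (\<lambda>x'. y < ereal (z + q x')) (at x)"
    by (rule order_tendstoD) (use z(1) in \<open>cases y; auto\<close>)
  ultimately show "eventually (\<lambda>x'. y < g x' + ereal (q x')) (at x)"
  proof eventually_elim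
    case (elim x')
    then show ?case by (cases y; cases "g x'") auto
  qed
qed

lemma lower_semicontinuous_open_superlevel:
  fixes F :: "'a::topological_space \<Rightarrow> ereal"
  assumes "lower_semicontinuous F"
  shows "open {x. c < F x}"
proof (subst open_subopen, clarify)
  fix x assume c: "c < F x"
  then have "eventually (\<lambda>y. c < F y) (at x)"
    by (rule lower_semicontinuousD[OF assms])
  with c have "eventually (\<lambda>y. c < F y) (nhds x)"
    by (simp add: eventually_nhds_conv_at)
  then show "\<exists>T. open T \<and> x \<in> T \<and> T \<subseteq> {x. c < F x}"
    by (auto simp: eventually_nhds)
qed

text \<open>
  If no point of the compact sublevel set were minimal, the open strict superlevel sets at its values
  would cover it; in a finite subcover, the point with the smallest value cannot be covered.
\<close>

lemma lsc_attains_minimum: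
  fixes F :: "'a::euclidean_space \<Rightarrow> ereal"
  assumes lsc: "lower_semicontinuous F" and bdd: "bounded {w. F w \<le> F x}"
  obtains w where "\<And>w'. F w \<le> F w'"
proof -
  define K where "K = {w. F w \<le> F x}"
  have "- K = {w. F x < F w}" by (auto simp: K_def)
  then have "closed K"
    using lower_semicontinuous_open_superlevel[OF lsc] by (simp add: closed_def)
  with bdd have "compact K" by (simp add: compact_eq_bounded_closed K_def)
  have "\<exists>w\<in>K. \<forall>w'\<in>K. F w \<le> F w'"
  proof (rule ccontr)
    assume "\<not> ?thesis"
    then have "K \<subseteq> (\<Union>c\<in>K. {w. F c < F w})" by (auto simp: not_le)
    then obtain C where C: "C \<subseteq> K" "finite C" "K \<subseteq> (\<Union>c\<in>C. {w. F c < F w})"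
      using compactE_image[OF \<open>compact K\<close>, of K "\<lambda>c. {w. F c < F w}"]
        lower_semicontinuous_open_superlevel[OF lsc] by metis
    have "x \<in> K" by (simp add: K_def)
    with C have "C \<noteq> {}" by auto
    with C have "Min (F ` C) \<in> F ` C" by (intro Min_in) auto
    then obtain c where c: "c \<in> C" "F c = Min (F ` C)" by auto
    with C obtain c' where "c' \<in> C" "F c' < F c" by blast
    with c C show False by (metis Min_le finite_imageI imageI not_less)
  qed
  then show thesis
    using that unfolding K_def by (metis linorder_linear mem_Collect_eq order_trans)
qed

section \<open>The proximal point and the proximal linearisation\<close>

locale smooth_step =
  fixes f :: "'a::euclidean_space \<Rightarrow> real" and L \<gamma> :: real
  assumes diff: "\<And>x. f differentiable (at x)"
    and lip: "L-lipschitz_on UNIV (grad f)"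
    and step_pos: "0 < \<gamma>"
    and step_less: "\<gamma> * L < 1"
begin

lemma L_nonneg: "0 \<le> L"
  using lip by (rule lipschitz_on_nonneg)

lemma grad_lipschitz: "norm (grad f x - grad f y) \<le> L * norm (x - y)"
  using lipschitz_onD[OF lip, of x y] by (simp add: dist_norm)

lemma linearisation_error:
  "\<bar>f w - f u - grad f u \<bullet> (w - u)\<bar> \<le> L / 2 * (norm (w - u))\<^sup>2"
  by (rule descent[OF GDERIV_grad[OF diff] lip])

lemma ex1_resolvent: "\<exists>!u. u + \<gamma> *\<^sub>R grad f u = s"
proof -
  have "\<exists>!u. s - \<gamma> *\<^sub>R grad f u = u"
  proof (rule banach_fix_type)
    show "0 \<le> \<gamma> * L" "\<gamma> * L < 1" using step_pos step_less L_nonneg by auto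
    show "\<forall>x y. dist (s - \<gamma> *\<^sub>R grad f x) (s - \<gamma> *\<^sub>R grad f y) \<le> \<gamma> * L * dist x y"
    proof (intro allI)
      fix x y
      have "dist (s - \<gamma> *\<^sub>R grad f x) (s - \<gamma> *\<^sub>R grad f y) = norm (\<gamma> *\<^sub>R (grad f y - grad f x))"
        by (simp add: dist_norm algebra_simps)
      also have "\<dots> \<le> \<gamma> * (L * norm (y - x))"
        using grad_lipschitz[of y x] step_pos by (simp add: mult_left_mono)
      finally show "dist (s - \<gamma> *\<^sub>R grad f x) (s - \<gamma> *\<^sub>R grad f y) \<le> \<gamma> * L * dist x y"
        by (simp add: dist_norm norm_minus_commute)
    qed
  qed
  moreover have "s - \<gamma> *\<^sub>R grad f u = u \<longleftrightarrow> u + \<gamma> *\<^sub>R grad f u = s" for u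
    by (auto simp: algebra_simps)
  ultimately show ?thesis by simp
qed

definition resolvent :: "'a \<Rightarrow> 'a" where
  "resolvent s = (THE u. u + \<gamma> *\<^sub>R grad f u = s)"

lemma resolvent_eq: "resolvent s + \<gamma> *\<^sub>R grad f (resolvent s) = s"
  unfolding resolvent_def by (rule theI'[OF ex1_resolvent])

lemma norm_resolvent_diff_le:
  "norm (resolvent s - resolvent t) \<le> norm (s - t) / (1 - \<gamma> * L)"
proof -
  let ?u = "resolvent s" and ?v = "resolvent t"
  have "?u - ?v = (s - t) - \<gamma> *\<^sub>R (grad f ?u - grad f ?v)"
    using resolvent_eq[of s] resolvent_eq[of t] by (simp add: algebra_simps)
  then have "norm (?u - ?v) \<le> norm (s - t) + norm (\<gamma> *\<^sub>R (grad f ?u - grad f ?v))"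
    by (metis norm_triangle_ineq4)
  also have "\<dots> \<le> norm (s - t) + \<gamma> * (L * norm (?u - ?v))"
    using grad_lipschitz[of ?u ?v] step_pos by (simp add: mult_left_mono)
  finally have "norm (?u - ?v) * (1 - \<gamma> * L) \<le> norm (s - t)"
    by (simp add: algebra_simps)
  then show ?thesis using step_less by (simp add: field_simps)
qed

text \<open>
  With \<open>\<nabla>f(u) = (s - u)/\<gamma>\<close> the cross terms cancel, and the proximal objective at \<open>w\<close> exceeds its value
  at \<open>u\<close> by at least \<open>(1/\<gamma> - L)/2 * norm (w - u)^2\<close>. So the solution supplied by the contraction is
  itself the unique minimiser.
\<close>

lemma prox_eq_resolvent: "prox \<gamma> (\<lambda>w. ereal (f w)) s = {resolvent s}"
proof -
  define u where "u = resolvent s"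
  let ?P = "\<lambda>w. f w + (norm (w - s))\<^sup>2 / (2 * \<gamma>)"
  have s: "s = u + \<gamma> *\<^sub>R grad f u" by (simp add: u_def resolvent_eq)
  have less: "?P u < ?P w" if "w \<noteq> u" for w
  proof -
    have "(norm (w - s))\<^sup>2 = (norm ((w - u) - (s - u)))\<^sup>2" by simp
    also have "\<dots> = (norm (w - u))\<^sup>2 - 2 * ((s - u) \<bullet> (w - u)) + (norm (u - s))\<^sup>2"
      by (simp only: power2_norm_eq_inner) (simp add: algebra_simps inner_commute)
    also have "(s - u) \<bullet> (w - u) = \<gamma> * (grad f u \<bullet> (w - u))"
      by (simp add: s)
    finally have "(norm (w - s))\<^sup>2 / (2 * \<gamma>)
        = (norm (w - u))\<^sup>2 / (2 * \<gamma>) - grad f u \<bullet> (w - u) + (norm (u - s))\<^sup>2 / (2 * \<gamma>)"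
      using step_pos by (simp add: add_divide_distrib diff_divide_distrib)
    then have "?P w - ?P u = f w - f u - grad f u \<bullet> (w - u) + (norm (w - u))\<^sup>2 / (2 * \<gamma>)"
      by simp
    moreover have "L / 2 * (norm (w - u))\<^sup>2 < (norm (w - u))\<^sup>2 / (2 * \<gamma>)"
    proof -
      have "\<gamma> * L * (norm (w - u))\<^sup>2 < 1 * (norm (w - u))\<^sup>2"
        using step_less that by (intro mult_strict_right_mono) auto
      then show ?thesis using step_pos by (simp add: field_simps)
    qed
    ultimately show ?thesis using linearisation_error[of w u] by linarith
  qed
  have "?P u \<le> ?P w" for w using less[of w] by (cases "w = u") auto
  with less have "is_arg_min (\<lambda>w. ereal (f w) + ereal ((norm (w - s))\<^sup>2 / (2 * \<gamma>))) (\<lambda>_. True) v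
      \<longleftrightarrow> v = u" for v
    unfolding is_arg_min_linorder by (auto simp flip: not_less)
  then show ?thesis by (simp add: prox_def argmin_set_def u_def)
qed

definition model :: "'a \<Rightarrow> 'a \<Rightarrow> real" where
  "model u w = f u + grad f u \<bullet> (w - u) + (norm (w - u))\<^sup>2 / (2 * \<gamma>)"

lemma model_lower: "f w + (1 - \<gamma> * L) / (2 * \<gamma>) * (norm (w - u))\<^sup>2 \<le> model u w"
  and model_upper: "model u w \<le> f w + (1 + \<gamma> * L) / (2 * \<gamma>) * (norm (w - u))\<^sup>2"
proof -
  let ?n = "(norm (w - u))\<^sup>2"
  have "(1 - \<gamma> * L) / (2 * \<gamma>) * ?n = ?n / (2 * \<gamma>) - L / 2 * ?n"
    "(1 + \<gamma> * L) / (2 * \<gamma>) * ?n = ?n / (2 * \<gamma>) + L / 2 * ?n"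
    using step_pos by (auto simp: field_simps)
  moreover have "f w - f u - grad f u \<bullet> (w - u) \<le> L / 2 * ?n"
    "- (L / 2 * ?n) \<le> f w - f u - grad f u \<bullet> (w - u)"
    using linearisation_error[of w u] by (auto simp only: abs_le_iff minus_le_iff)
  ultimately show "f w + (1 - \<gamma> * L) / (2 * \<gamma>) * ?n \<le> model u w"
    and "model u w \<le> f w + (1 + \<gamma> * L) / (2 * \<gamma>) * ?n"
    by (simp_all add: model_def)
qed

text \<open>
  Moving the base point along the linearisation at \<open>u\<close> itself changes nothing. So the difference
  consists of the linearisation error at \<open>v\<close>, the change of the gradient tested against \<open>w - v\<close>,
  and the change of the proximal term; each of these is controlled by \<open>norm (v - u)\<close>, with no
  bound on the gradient itself entering the constant.
\<close>

lemma model_diff_le: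
  assumes w: "norm (w - u) \<le> R" and v: "norm (v - u) \<le> D"
  shows "model v w - model u w \<le> (L / 2 * D + L * (R + D) + (2 * R + D) / (2 * \<gamma>)) * norm (v - u)"
proof -
  define d where "d = norm (v - u)"
  have d: "0 \<le> d" "d \<le> D" using v by (auto simp: d_def)
  have wv: "norm (w - v) \<le> R + D"
    using norm_triangle_ineq4[of "w - u" "v - u"] w v by simp
  have eq: "model v w - model u w = (f v - f u - grad f u \<bullet> (v - u))
      + (grad f v - grad f u) \<bullet> (w - v) + ((norm (w - v))\<^sup>2 - (norm (w - u))\<^sup>2) / (2 * \<gamma>)"
    by (simp add: model_def algebra_simps diff_divide_distrib)
  have 1: "f v - f u - grad f u \<bullet> (v - u) \<le> L / 2 * D * d"
  proof -
    have "f v - f u - grad f u \<bullet> (v - u) \<le> L / 2 * d\<^sup>2"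
      using linearisation_error[of v u] unfolding d_def by linarith
    also have "\<dots> \<le> L / 2 * (D * d)"
      using d L_nonneg by (intro mult_left_mono) (auto simp: power2_eq_square mult_right_mono)
    finally show ?thesis by simp
  qed
  have 2: "(grad f v - grad f u) \<bullet> (w - v) \<le> L * (R + D) * d"
  proof -
    have "(grad f v - grad f u) \<bullet> (w - v) \<le> norm (grad f v - grad f u) * norm (w - v)"
      by (rule norm_cauchy_schwarz)
    also have "\<dots> \<le> (L * d) * (R + D)"
      using grad_lipschitz[of v u] wv d L_nonneg by (intro mult_mono) (auto simp: d_def)
    finally show ?thesis by (simp add: mult_ac)
  qed
  have "(norm (w - v))\<^sup>2 - (norm (w - u))\<^sup>2 = (norm (w - v) - norm (w - u)) * (norm (w - v) + norm (w - u))"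
    by (simp add: power2_eq_square algebra_simps)
  also have "\<dots> \<le> d * (2 * R + D)"
  proof (rule mult_mono)
    show "norm (w - v) - norm (w - u) \<le> d"
      using norm_triangle_ineq4[of "w - u" "v - u"] by (simp add: d_def)
  qed (use wv w d in auto)
  finally have 3: "((norm (w - v))\<^sup>2 - (norm (w - u))\<^sup>2) / (2 * \<gamma>) \<le> (2 * R + D) / (2 * \<gamma>) * d"
    using step_pos by (simp add: divide_right_mono mult.commute)
  from 1 2 3 show ?thesis
    unfolding eq d_def[symmetric] by (simp add: distrib_right)
qed

section \<open>The envelope\<close>

definition kappa :: real where
  "kappa = sqrt ((1 + \<gamma> * L) / (1 - \<gamma> * L))"

text \<open>
  Minimality of \<open>f + g\<close> at \<open>x\<close> turns \<open>g w + model u w \<le> g x + model u x\<close> into a comparison of the two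
  quadratic terms in the bounds for the model.
\<close>

lemma sublevel_bound:
  assumes g: "proper g" and x: "x \<in> argmin_set (\<lambda>x. ereal (f x) + g x)"
    and le: "g w + ereal (model u w) \<le> g x + ereal (model u x)"
  shows "norm (w - u) \<le> kappa * norm (x - u)"
proof -
  have min: "ereal (f x) + g x \<le> ereal (f y) + g y" for y
    using x by (simp add: argmin_set_def is_arg_min_linorder)
  obtain y where "g y \<noteq> \<infinity>" using g by (auto simp: proper_def)
  with min[of y] have "g x \<noteq> \<infinity>" by (cases "g y") auto
  then obtain a where a: "g x = ereal a" using g by (cases "g x") (auto simp: proper_def)
  with le obtain b where b: "g w = ereal b" using g by (cases "g w") (auto simp: proper_def)
  have "f x + a \<le> f w + b" "b + model u w \<le> a + model u x"
    using min[of w] le a b by auto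
  with model_lower[of w u] model_upper[of u x]
  have "(1 - \<gamma> * L) / (2 * \<gamma>) * (norm (w - u))\<^sup>2 \<le> (1 + \<gamma> * L) / (2 * \<gamma>) * (norm (x - u))\<^sup>2"
    by linarith
  then have "(1 - \<gamma> * L) * (norm (w - u))\<^sup>2 \<le> (1 + \<gamma> * L) * (norm (x - u))\<^sup>2"
    using step_pos by (simp add: divide_le_cancel)
  then have "(norm (w - u))\<^sup>2 \<le> (1 + \<gamma> * L) / (1 - \<gamma> * L) * (norm (x - u))\<^sup>2"
    using step_less by (simp add: pos_le_divide_eq mult.commute)
  then have "norm (w - u) \<le> sqrt ((1 + \<gamma> * L) / (1 - \<gamma> * L) * (norm (x - u))\<^sup>2)"
    by (rule real_le_rsqrt)
  then show ?thesis by (simp only: real_sqrt_mult real_sqrt_abs kappa_def abs_norm_cancel)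
qed

lemma DR_envelope_attained:
  assumes g: "proper g" "lower_semicontinuous g"
    and x: "x \<in> argmin_set (\<lambda>x. ereal (f x) + g x)"
  obtains w b where "g w = ereal b"
    and "DR_envelope \<gamma> f g s = ereal (b + model (resolvent s) w)"
    and "norm (w - resolvent s) \<le> kappa * norm (x - resolvent s)"
    and "\<And>w'. DR_envelope \<gamma> f g s \<le> g w' + ereal (model (resolvent s) w')"
proof -
  define u where "u = resolvent s"
  define F where "F = (\<lambda>w. g w + ereal (model u w))"
  have "continuous_on UNIV (model u)"
    unfolding model_def by (intro continuous_intros) (use step_pos in auto)
  then have "lower_semicontinuous F"
    unfolding F_def by (rule lower_semicontinuous_add_continuous[OF g(2)])
  moreover have bound: "norm (w - u) \<le> kappa * norm (x - u)" if "F w \<le> F x" for w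
    using sublevel_bound[OF g(1) x] that by (simp add: F_def)
  have "{w. F w \<le> F x} \<subseteq> cball u (kappa * norm (x - u))"
    using bound by (auto simp: dist_norm norm_minus_commute)
  then have "bounded {w. F w \<le> F x}" by (rule bounded_subset[OF bounded_cball])
  ultimately obtain w where w: "\<And>w'. F w \<le> F w'" by (rule lsc_attains_minimum) blast
  have E: "DR_envelope \<gamma> f g s = F w"
  proof -
    have "DR_envelope \<gamma> f g s = (LEAST m. m \<in> range F)"
      by (simp add: DR_envelope_def Let_def prox_eq_resolvent u_def F_def model_def)
    also have "\<dots> = F w" by (rule Least_equality) (use w in auto)
    finally show ?thesis .
  qed
  obtain y where "g y \<noteq> \<infinity>" using g by (auto simp: proper_def)
  with w[of y] have "g w \<noteq> \<infinity>" by (cases "g y") (auto simp: F_def)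
  then obtain b where "g w = ereal b" using g by (cases "g w") (auto simp: proper_def)
  then show thesis
    using that[of w b] E w bound[OF w] by (simp add: F_def u_def)
qed

lemma DR_envelope_strictly_continuous:
  assumes g: "proper g" "lower_semicontinuous g"
    and x: "x \<in> argmin_set (\<lambda>x. ereal (f x) + g x)"
  shows "strictly_continuous (\<lambda>s. real_of_ereal (DR_envelope \<gamma> f g s))"
  unfolding strictly_continuous_def
proof
  fix s0
  define \<rho> where "\<rho> = 1 / (1 - \<gamma> * L)"
  have rho: "0 < \<rho>" using step_less by (simp add: \<rho>_def)
  have res: "norm (resolvent s - resolvent t) \<le> \<rho> * norm (s - t)" for s t
    using norm_resolvent_diff_le[of s t] by (simp add: \<rho>_def)
  have kappa: "0 \<le> kappa"
    using step_pos step_less L_nonneg by (simp add: kappa_def)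
  \<comment> \<open>On the unit ball around \<open>s0\<close>, resolvents are within \<open>\<rho>\<close> of that of \<open>s0\<close>; \<open>R\<close> and \<open>2 * \<rho>\<close> bound
    the two distances that enter the estimate for the model.\<close>
  define R where "R = kappa * (norm (x - resolvent s0) + \<rho>)"
  define C where "C = L / 2 * (2 * \<rho>) + L * (R + 2 * \<rho>) + (2 * R + 2 * \<rho>) / (2 * \<gamma>)"
  have "0 \<le> R" using kappa rho by (simp add: R_def)
  then have C: "0 \<le> C" using rho L_nonneg step_pos by (simp add: C_def)
  let ?E = "\<lambda>s. real_of_ereal (DR_envelope \<gamma> f g s)"
  have le: "?E t - ?E s \<le> C * \<rho> * dist t s" if "s \<in> ball s0 1" "t \<in> ball s0 1" for s t
  proof -
    let ?u = "resolvent s" and ?v = "resolvent t"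
    have "norm (s - s0) \<le> 1" using that by (simp add: dist_norm norm_minus_commute)
    then have "norm (?u - resolvent s0) \<le> \<rho>"
      using res[of s s0] rho by (meson mult_left_le order_trans less_imp_le)
    then have u: "norm (x - ?u) \<le> norm (x - resolvent s0) + \<rho>"
      using norm_triangle_ineq4[of "x - resolvent s0" "?u - resolvent s0"] by simp
    have "norm (t - s) \<le> 2"
      using that dist_triangle_less_add[of s s0 1 t 1]
      by (simp add: dist_norm norm_minus_commute)
    then have v: "norm (?v - ?u) \<le> 2 * \<rho>"
      using res[of t s] mult_left_mono[OF _ less_imp_le[OF rho], of "norm (t - s)" 2] by simp
    obtain w b where w: "g w = ereal b" "DR_envelope \<gamma> f g s = ereal (b + model ?u w)"
        "norm (w - ?u) \<le> kappa * norm (x - ?u)"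
      using DR_envelope_attained[OF g x, of s] by metis
    obtain w' b' where w': "DR_envelope \<gamma> f g t = ereal (b' + model ?v w')"
        "DR_envelope \<gamma> f g t \<le> g w + ereal (model ?v w)"
      using DR_envelope_attained[OF g x, of t] by metis
    have "norm (w - ?u) \<le> R"
      using w(3) mult_left_mono[OF u kappa] by (simp add: R_def)
    have "?E t - ?E s \<le> model ?v w - model ?u w"
      using w w' by simp
    also have "\<dots> \<le> C * norm (?v - ?u)"
      unfolding C_def by (rule model_diff_le[OF \<open>norm (w - ?u) \<le> R\<close> v])
    also have "\<dots> \<le> C * (\<rho> * norm (t - s))"
      using res C by (rule mult_left_mono)
    finally show ?thesis by (simp add: dist_norm)
  qed
  have "(C * \<rho>)-lipschitz_on (ball s0 1) ?E"
  proof (rule lipschitz_onI)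
    fix s t assume "s \<in> ball s0 1" "t \<in> ball s0 1"
    with le[of s t] le[of t s] show "dist (?E s) (?E t) \<le> C * \<rho> * dist s t"
      by (simp add: dist_real_def dist_commute abs_le_iff)
  qed (use C rho in simp)
  then show "\<exists>e>0. \<exists>K. K-lipschitz_on (ball s0 e) ?E"
    by (intro exI[of _ 1]) auto
qed

end

theorem proposition3p2:
  fixes \<phi>1 :: "real ^ 'p \<Rightarrow> real" and \<phi>2 :: "real ^ 'p \<Rightarrow> ereal" and L \<gamma> :: real
  assumes "\<And>x. \<phi>1 differentiable (at x)"
    and "L-lipschitz_on UNIV (grad \<phi>1)"
    and "proper \<phi>2"
    and "lower_semicontinuous \<phi>2"
    and "argmin_set (\<lambda>x. ereal (\<phi>1 x) + \<phi>2 x) \<noteq> {}"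
    and "0 < \<gamma>"
    and "ereal \<gamma> < 1 / ereal L"
  shows "(\<forall>s. \<bar>DR_envelope \<gamma> \<phi>1 \<phi>2 s\<bar> \<noteq> \<infinity>) \<and>
    strictly_continuous (\<lambda>s. real_of_ereal (DR_envelope \<gamma> \<phi>1 \<phi>2 s))"
proof -
  have "0 \<le> L" using assms(2) by (rule lipschitz_on_nonneg)
  \<comment> \<open>For \<open>L = 0\<close> the bound on \<open>\<gamma>\<close> is infinite, but the product still vanishes.\<close>
  have "\<gamma> * L < 1"
  proof (cases "L = 0")
    case False
    with \<open>0 \<le> L\<close> assms(7) show ?thesis by (simp add: one_ereal_def field_simps)
  qed simp
  with assms interpret smooth_step \<phi>1 L \<gamma> by unfold_locales
  obtain x where x: "x \<in> argmin_set (\<lambda>x. ereal (\<phi>1 x) + \<phi>2 x)"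
    using assms(5) by blast
  have "\<bar>DR_envelope \<gamma> \<phi>1 \<phi>2 s\<bar> \<noteq> \<infinity>" for s
    by (rule DR_envelope_attained[OF assms(3,4) x, of s]) simp
  with DR_envelope_strictly_continuous[OF assms(3,4) x] show ?thesis by blast
qed

end
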